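(* Let $\mathbf{A}\in\mathbb{R}^{N\times N}$ be symmetric with eigenpairs $(\lambda_j,\bm{v}_j)$, $j=1,\dots,N$, where $\bm{v}_1,\dots,\bm{v}_N$ are orthonormal and $1=\lambda_1>|\lambda_2|\ge\cdots\ge|\lambda_N|$. Let $\bm{\widehat v}_0\in\mathbb{R}^N$ be a fixed initial vector, and for $k\ge1$ define $$\bm{\widehat v}_k=\frac{N}{\mathbb{E}[T]}\mathbf{A}\mathbf{D}_{\mathcal{T}_k}\bm{\widehat v}_{k-1},\qquad \bm{\widehat m}_k=\frac{k-1}{k}\bm{\widehat m}_{k-1}+\frac1k\bm{\widehat v}_k,\qquad \bm{\widehat m}_0=0.$$ Let $\mathbf{A}^k\bm{\widehat v}_0$ converge to $\bm{v}_1$ as $k\to\infty$. Then there is a real number $\phi\neq0$ such that $$\lim_{k\to\infty}\mathbb{E}[\bm{\widehat m}_k]=\phi\,\bm{v}_1.$$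
   Context: For a subset $\mathcal{S}\subseteq\{1,\dots,N\}$, $\mathbf{D}_{\mathcal{S}}=\sum_{i\in\mathcal{S}}\bm{e}_i\bm{e}_i^\top$, where $\bm{e}_i$ is the $i$-th column of the $N\times N$ identity matrix. Random index sets: fix integers $1\le\gamma_1\le\gamma_2\le N$. $T$ is a random integer uniformly distributed on $\{\gamma_1,\dots,\gamma_2\}$, and, given $T$, $\mathcal{T}$ is a uniformly distributed size-$T$ subset of $\{1,\dots,N\}$. The pairs $(T_k,\mathcal{T}_k)$, $k\ge1$, are independent and identically distributed copies of $(T,\mathcal{T})$. The expectation is over the random index sets; $\bm{\widehat v}_0$ (chosen at random by the user) is regarded as fixed. *)

theory Defs
  imports "HOL-Analysis.Analysis" "HOL-Probability.Probability"
begin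

text \<open>The vector $e_i$ is column \<open>i\<close> of the identity matrix, and $e_i e_i^T$ is the product
  of an $N \times 1$ by a $1 \times N$ matrix.\<close>

definition coord_proj :: "'n set \<Rightarrow> real^'n^'n" where
  "coord_proj S = (\<Sum>i\<in>S. (columnvector (column i (mat 1 :: real^'n^'n)) :: real^1^'n)
                         ** (rowvector (column i (mat 1 :: real^'n^'n)) :: real^'n^1))"

text \<open>On \<^typ>\<open>real^'n^'n\<close> the library's \<open>*\<close> is the entrywise product,
  so matrix powers need their own definition.\<close>

primrec matrix_pow :: "real^'n^'n \<Rightarrow> nat \<Rightarrow> real^'n^'n" where
  "matrix_pow A 0 = mat 1"
| "matrix_pow A (Suc k) = A ** matrix_pow A k"

definition size_pmf :: "nat \<Rightarrow> nat \<Rightarrow> nat pmf" where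
  "size_pmf g1 g2 = pmf_of_set {g1..g2}"

definition mean_size :: "nat \<Rightarrow> nat \<Rightarrow> real" where
  "mean_size g1 g2 = measure_pmf.expectation (size_pmf g1 g2) real"

text \<open>Joint law of $(T, \mathcal{T})$. Only meaningful for \<open>g1 \<le> g2 \<le> CARD('n)\<close>, as
  otherwise \<^const>\<open>pmf_of_set\<close> gets applied to an empty set.\<close>

definition index_pmf :: "nat \<Rightarrow> nat \<Rightarrow> (nat \<times> 'n::finite set) pmf" where
  "index_pmf g1 g2 = bind_pmf (size_pmf g1 g2)
     (\<lambda>t. map_pmf (\<lambda>S. (t, S)) (pmf_of_set {S. card S = t}))"

text \<open>\<open>S k\<close> is the index set used in step \<open>k \<ge> 1\<close>; \<open>S 0\<close> is never used.\<close>

primrec v_hat :: "real^'n^'n \<Rightarrow> nat \<Rightarrow> nat \<Rightarrow> real^'n \<Rightarrow> (nat \<Rightarrow> 'n set) \<Rightarrow> nat \<Rightarrow> real^'n" where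
  "v_hat A g1 g2 v0 S 0 = v0"
| "v_hat A g1 g2 v0 S (Suc k) =
     (real CARD('n) / mean_size g1 g2) *\<^sub>R ((A ** coord_proj (S (Suc k))) *v v_hat A g1 g2 v0 S k)"

primrec m_hat :: "real^'n^'n \<Rightarrow> nat \<Rightarrow> nat \<Rightarrow> real^'n \<Rightarrow> (nat \<Rightarrow> 'n set) \<Rightarrow> nat \<Rightarrow> real^'n" where
  "m_hat A g1 g2 v0 S 0 = 0"
| "m_hat A g1 g2 v0 S (Suc k) =
     (real k / real (Suc k)) *\<^sub>R m_hat A g1 g2 v0 S k
     + (1 / real (Suc k)) *\<^sub>R v_hat A g1 g2 v0 S (Suc k)"

end

theory Submission
  imports Defs
begin

text \<open>
  A uniformly random set of size \<open>t\<close> contains a given index with probability \<open>t / N\<close>, so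
  averaging over \<open>t\<close> shows that every index is selected with the same probability
  \<open>E[T] / N\<close> (\<open>expectation_indicator_index_pmf\<close>). Hence the expected
  projection is a multiple of the identity, and the factor \<open>N / E[T]\<close> makes a single step
  agree on average with multiplication by \<open>A\<close>. As the index set used in step \<open>k + 1\<close> is
  independent of the iterate reached after \<open>k\<close> steps, expectations multiply, and by induction
  the expected iterate is exactly \<open>A\<^sup>k v\<^sub>0\<close> (\<open>has_bochner_integral_v_hat\<close>).

  The recursion for \<open>m_hat\<close> computes the arithmetic mean of the iterates
  (\<open>m_hat_eq_average\<close>), so its expectation is the mean of \<open>A v\<^sub>0, \<dots>, A\<^sup>k v\<^sub>0\<close>.
  Means of a convergent sequence converge to the same limit (\<open>tendsto_average\<close>), which
  here is \<open>v\<^sub>1\<close>; thus the constant is \<open>\<phi> = 1\<close>.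
\<close>

section \<open>Arithmetic means of convergent sequences\<close>

text \<open>Cesaro's theorem: for large \<open>n\<close> all but a fixed number of the terms are within
  \<open>e / 2\<close> of the limit, and the total error of the remaining terms is divided by \<open>n\<close>.\<close>

lemma tendsto_average:
  fixes X :: "nat \<Rightarrow> 'a::real_normed_vector"
  assumes "X \<longlonglongrightarrow> L"
  shows "(\<lambda>n. (1 / real n) *\<^sub>R (\<Sum>j=1..n. X j)) \<longlonglongrightarrow> L"
proof (rule LIMSEQ_I)
  fix e :: real assume "e > 0"
  then obtain N where N: "\<And>n. n \<ge> N \<Longrightarrow> norm (X n - L) < e / 2"
    using LIMSEQ_D[OF assms, of "e / 2"] by auto
  define C where "C = (\<Sum>j=1..N. norm (X j - L))"
  obtain K :: nat where K: "real K > 2 * C / e"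
    using reals_Archimedean2 by blast
  show "\<exists>no. \<forall>n\<ge>no. norm ((1 / real n) *\<^sub>R (\<Sum>j=1..n. X j) - L) < e"
  proof (intro exI allI impI)
    fix n assume n: "n \<ge> max 1 K"
    then have "real n > 0" by simp
    have "real n > 2 * C / e" using n K by simp
    then have Cn: "C < real n * (e / 2)"
      using \<open>e > 0\<close> by (simp add: field_simps)
    have "(\<Sum>j=1..n. norm (X j - L)) \<le> (\<Sum>j=1..n. (if j \<le> N then norm (X j - L) else 0) + e / 2)"
      using N \<open>e > 0\<close> by (intro sum_mono) (auto simp: not_le intro: less_imp_le)
    also have "\<dots> = (\<Sum>j | j \<in> {1..n} \<and> j \<le> N. norm (X j - L)) + real n * (e / 2)"
      by (simp only: sum.distrib sum.inter_filter finite_atLeastAtMost) simp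
    also have "(\<Sum>j | j \<in> {1..n} \<and> j \<le> N. norm (X j - L)) \<le> C"
      unfolding C_def by (rule sum_mono2) auto
    finally have bound: "(\<Sum>j=1..n. norm (X j - L)) < real n * e"
      using Cn by (simp add: field_simps)
    have "(1 / real n) *\<^sub>R (\<Sum>j=1..n. X j) - L = (1 / real n) *\<^sub>R (\<Sum>j=1..n. X j - L)"
      using \<open>real n > 0\<close> by (simp add: sum_subtractf scaleR_right_diff_distrib sum_constant_scaleR)
    also have "norm \<dots> \<le> (1 / real n) * (\<Sum>j=1..n. norm (X j - L))"
      using norm_sum[of "\<lambda>j. X j - L" "{1..n}"] by (simp add: divide_right_mono)
    also have "\<dots> < e"
      using bound \<open>real n > 0\<close> by (simp add: field_simps)
    finally show "norm ((1 / real n) *\<^sub>R (\<Sum>j=1..n. X j) - L) < e" .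
  qed
qed

lemma m_hat_eq_average:
  "m_hat A g1 g2 v0 S k = (1 / real k) *\<^sub>R (\<Sum>j=1..k. v_hat A g1 g2 v0 S j)"
proof (induction k)
  case (Suc k)
  then show ?case by (cases "k = 0") (simp_all add: scaleR_add_right)
qed simp

section \<open>The probability that an index is selected\<close>

lemma card_subsets_containing:
  fixes i :: "'n::finite"
  assumes "1 \<le> t"
  shows "card {S. card S = t \<and> i \<in> S} = (CARD('n) - 1) choose (t - 1)"
proof -
  have "bij_betw (insert i) {S. S \<subseteq> UNIV - {i} \<and> card S = t - 1} {S. card S = t \<and> i \<in> S}"
    using assms by (intro bij_betwI[where g = "\<lambda>S. S - {i}"])
      (auto simp: card_insert_if subset_Diff_insert)
  from bij_betw_same_card[OF this] show ?thesis
    by (simp add: n_subsets)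
qed

text \<open>Counting the pairs of a set of size \<open>t\<close> and one of its elements in two ways gives
  \<open>t \<cdot> (N choose t) = N \<cdot> (N - 1 choose (t - 1))\<close>, which turns the quotient of the two numbers
  of sets into \<open>t / N\<close>.\<close>

lemma expectation_indicator_uniform_subset:
  fixes i :: "'n::finite"
  assumes "1 \<le> t" "t \<le> CARD('n)"
  shows "measure_pmf.expectation (pmf_of_set {S :: 'n set. card S = t}) (\<lambda>S. indicator S i)
           = real t / real CARD('n)"
proof -
  have card: "card {S :: 'n set. card S = t} = CARD('n) choose t"
    using n_subsets[of "UNIV :: 'n set" t] by simp
  have pos: "CARD('n) choose t > 0"
    using assms by simp
  have ne: "{S :: 'n set. card S = t} \<noteq> {}"
    using card pos by (metis card.empty less_irrefl)
  have "(\<Sum>S | card S = t. indicator S i :: real) = real (card {S. card S = t \<and> i \<in> S})"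
    by (simp add: indicator_def of_bool_def sum.If_cases Int_def)
  moreover have "t * (CARD('n) choose t) = CARD('n) * ((CARD('n) - 1) choose (t - 1))"
    using assms by (intro times_binomial_minus1_eq) simp
  then have "real t * real (CARD('n) choose t)
               = real CARD('n) * real ((CARD('n) - 1) choose (t - 1))"
    by (metis of_nat_mult)
  ultimately show ?thesis
    using ne assms by (simp add: integral_pmf_of_set card card_subsets_containing[OF assms(1)]
        field_simps)
qed

lemma mean_size_eq: "g1 \<le> g2 \<Longrightarrow> mean_size g1 g2 = (\<Sum>t=g1..g2. real t) / real (card {g1..g2})"
  unfolding mean_size_def size_pmf_def by (subst integral_pmf_of_set) auto

lemma mean_size_pos:
  assumes "1 \<le> g1" "g1 \<le> g2"
  shows "mean_size g1 g2 > 0"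
proof -
  have "(\<Sum>t=g1..g2. real t) > 0"
    using assms by (intro sum_pos) auto
  then show ?thesis
    using assms by (simp add: mean_size_eq)
qed

lemma expectation_indicator_index_pmf:
  fixes i :: "'n::finite"
  assumes "1 \<le> g1" "g1 \<le> g2" "g2 \<le> CARD('n)"
  shows "measure_pmf.expectation (index_pmf g1 g2 :: (nat \<times> 'n set) pmf) (\<lambda>x. indicator (snd x) i)
           = mean_size g1 g2 / real CARD('n)"
proof -
  have "measure_pmf.expectation (index_pmf g1 g2 :: (nat \<times> 'n set) pmf) (\<lambda>x. indicator (snd x) i)
        = (\<Sum>t=g1..g2. measure_pmf.expectation (pmf_of_set {S :: 'n set. card S = t})
              (\<lambda>S. indicator S i :: real) /\<^sub>R real (card {g1..g2}))"
    unfolding index_pmf_def size_pmf_def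
    using assms by (subst pmf_expectation_bind_pmf_of_set) auto
  also have "\<dots> = (\<Sum>t=g1..g2. (real t / real CARD('n)) /\<^sub>R real (card {g1..g2}))"
    using assms by (intro sum.cong) (auto simp: expectation_indicator_uniform_subset)
  also have "\<dots> = mean_size g1 g2 / real CARD('n)"
    using assms by (simp add: mean_size_eq sum_divide_distrib field_simps)
  finally show ?thesis .
qed

section \<open>The expected iterates\<close>

text \<open>Expanding the projection in the standard basis separates the random index set from
  the vector: each summand is a product of two real factors, to which independence applies.\<close>

lemma coord_proj_mult:
  "coord_proj S *v (w :: real^'n) = (\<Sum>i\<in>UNIV. (indicator S i * w $ i) *\<^sub>R axis i 1)"
proof -
  have "(coord_proj S :: real^'n^'n) $ a $ b = (if a = b \<and> a \<in> S then 1 else 0)" for a b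
  proof -
    have "(coord_proj S :: real^'n^'n) $ a $ b
          = (\<Sum>i\<in>S. (if a = i then 1 else 0) * (if b = i then 1 else 0))"
      by (simp add: coord_proj_def columnvector_def rowvector_def matrix_matrix_mult_def
          column_def mat_def)
    also have "\<dots> = (\<Sum>i\<in>S. if a = i then (if a = b then 1 else 0) else 0)"
      by (rule sum.cong) auto
    finally show ?thesis by (simp add: sum.delta')
  qed
  then have "(coord_proj S *v w) $ a = (\<Sum>b\<in>UNIV. if a = b then indicator S a * w $ a else 0)" for a
    unfolding matrix_vector_mult_def vec_lambda_beta by (intro sum.cong) (auto simp: indicator_def)
  moreover have "(\<Sum>i\<in>UNIV. (indicator S i * w $ i) *\<^sub>R axis i 1) $ a
                   = (\<Sum>b\<in>UNIV. if a = b then indicator S a * w $ a else 0)" for a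
    unfolding sum_component by (intro sum.cong) (auto simp: axis_def)
  ultimately show ?thesis
    by (simp add: vec_eq_iff)
qed

lemma v_hat_cong:
  "(\<And>j. j \<in> {1..k} \<Longrightarrow> S j = S' j) \<Longrightarrow> v_hat A g1 g2 v0 S k = v_hat A g1 g2 v0 S' k"
  by (induction k) auto

lemma borel_measurable_matrix_vector_mult [measurable]:
  fixes A :: "real^'n^'m"
  shows "(*v) A \<in> borel_measurable borel"
  by (intro borel_measurable_continuous_onI linear_continuous_on
      matrix_vector_mul_bounded_linear)

lemma borel_measurable_vec_nth [measurable]:
  "(\<lambda>x::real^'n. x $ i) \<in> borel_measurable borel"
  by (intro borel_measurable_continuous_onI linear_continuous_on bounded_linear_vec_nth)

lemma measurable_v_hat:
  fixes A :: "real^'n^'n"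
  assumes "{1..k} \<subseteq> J"
  shows "(\<lambda>S. v_hat A g1 g2 v0 S k) \<in> borel_measurable (PiM J (\<lambda>_. count_space UNIV))"
  using assms
proof (induction k)
  case (Suc k)
  have [measurable]: "(\<lambda>S. v_hat A g1 g2 v0 S k) \<in> borel_measurable (PiM J (\<lambda>_. count_space UNIV))"
    using Suc.prems by (intro Suc.IH) (auto simp: subset_iff)
  have "Suc k \<in> J" using Suc.prems by auto
  then have [measurable]: "(\<lambda>S. S (Suc k)) \<in> PiM J (\<lambda>_. count_space UNIV) \<rightarrow>\<^sub>M count_space UNIV"
    by (rule measurable_component_singleton)
  have [measurable]: "(\<lambda>S. indicator (S (Suc k)) i :: real)
          \<in> borel_measurable (PiM J (\<lambda>_. count_space UNIV))" for i :: 'n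
    by (rule measurable_compose[of _ _ "count_space UNIV" "\<lambda>S. indicator S i"]) measurable
  show ?case
    by (simp add: matrix_vector_mul_assoc[symmetric] coord_proj_mult)
qed simp

context prob_space
begin

text \<open>The iterate after \<open>k\<close> steps is a function of the first \<open>k\<close> index sets only.\<close>

lemma indep_var_indicator_v_hat:
  fixes A :: "real^'n^'n"
  assumes "indep_vars (\<lambda>_. count_space UNIV) S {1..}"
  shows "indep_var borel (\<lambda>\<omega>. indicator (S (Suc k) \<omega>) i :: real)
           borel (\<lambda>\<omega>. v_hat A g1 g2 v0 (\<lambda>j. S j \<omega>) k $ i)"
proof -
  let ?M = "\<lambda>J. PiM J (\<lambda>_. count_space (UNIV :: 'n set set))"
  have "(\<lambda>f. f (Suc k)) \<in> ?M {Suc k} \<rightarrow>\<^sub>M count_space UNIV"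
    by (rule measurable_component_singleton) simp
  then have ind: "(\<lambda>f. indicator (f (Suc k)) i :: real) \<in> borel_measurable (?M {Suc k})"
    by (rule measurable_compose[of _ _ "count_space UNIV" "\<lambda>S. indicator S i"]) measurable
  have [measurable]: "(\<lambda>f. v_hat A g1 g2 v0 f k) \<in> borel_measurable (?M {1..k})"
    by (rule measurable_v_hat) simp
  have vec: "(\<lambda>f. v_hat A g1 g2 v0 f k $ i) \<in> borel_measurable (?M {1..k})"
    by measurable
  have "indep_var (?M {Suc k}) (\<lambda>\<omega>. restrict (\<lambda>j. S j \<omega>) {Suc k})
          (?M {1..k}) (\<lambda>\<omega>. restrict (\<lambda>j. S j \<omega>) {1..k})"
    using assms by (intro indep_var_restrict) auto
  from indep_var_compose[OF this ind vec]
  have "indep_var borel (\<lambda>\<omega>. indicator (S (Suc k) \<omega>) i :: real)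
          borel (\<lambda>\<omega>. v_hat A g1 g2 v0 (restrict (\<lambda>j. S j \<omega>) {1..k}) k $ i)"
    by (simp add: comp_def)
  moreover have "v_hat A g1 g2 v0 (restrict (\<lambda>j. S j \<omega>) {1..k}) k
                   = v_hat A g1 g2 v0 (\<lambda>j. S j \<omega>) k" for \<omega>
    by (rule v_hat_cong) simp
  ultimately show ?thesis by simp
qed

text \<open>Integrability is part of the induction because the product rule for expectations of
  independent variables presupposes it.\<close>

lemma has_bochner_integral_v_hat:
  fixes A :: "real^'n^'n"
  assumes indep: "indep_vars (\<lambda>_. count_space UNIV) S {1..}"
    and prob_mem: "\<And>k i. 1 \<le> k \<Longrightarrow>
          expectation (\<lambda>\<omega>. indicator (S k \<omega>) i) = mean_size g1 g2 / real CARD('n)"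
    and pos: "mean_size g1 g2 > 0"
  shows "has_bochner_integral M (\<lambda>\<omega>. v_hat A g1 g2 v0 (\<lambda>j. S j \<omega>) k) (matrix_pow A k *v v0)"
proof (induction k)
  case 0
  have "has_bochner_integral M (\<lambda>\<omega>. v0) (prob (space M) *\<^sub>R v0)"
    by (simp add: has_bochner_integral_iff)
  then show ?case by (simp add: prob_space)
next
  case (Suc k)
  let ?w = "\<lambda>\<omega>. v_hat A g1 g2 v0 (\<lambda>j. S j \<omega>) k"
  let ?c = "real CARD('n) / mean_size g1 g2"
  let ?E = "matrix_pow A k *v v0"
  have w: "has_bochner_integral M (\<lambda>\<omega>. ?w \<omega> $ i) (?E $ i)" for i
    by (rule has_bochner_integral_bounded_linear[OF bounded_linear_vec_nth Suc])
  have "random_variable (count_space UNIV) (S (Suc k))"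
    using indep by (simp add: indep_vars_def)
  then have [measurable]: "(\<lambda>\<omega>. indicator (S (Suc k) \<omega>) i :: real) \<in> borel_measurable M" for i
    by (rule measurable_compose[of _ _ "count_space UNIV" "\<lambda>S. indicator S i"]) measurable
  have ind: "integrable M (\<lambda>\<omega>. indicator (S (Suc k) \<omega>) i :: real)" for i
    by (rule integrable_const_bound[where B = 1], simp add: indicator_def) measurable
  have "has_bochner_integral M (\<lambda>\<omega>. indicator (S (Suc k) \<omega>) i * ?w \<omega> $ i)
          (mean_size g1 g2 / real CARD('n) * ?E $ i)" for i
    using indep_var_integrable[OF indep_var_indicator_v_hat[OF indep] ind]
      indep_var_lebesgue_integral[OF indep_var_indicator_v_hat[OF indep] ind]
      w[of i] prob_mem[of "Suc k" i]
    by (simp add: has_bochner_integral_iff)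
  then have "has_bochner_integral M (\<lambda>\<omega>. \<Sum>i\<in>UNIV. (indicator (S (Suc k) \<omega>) i * ?w \<omega> $ i) *\<^sub>R axis i 1)
          (\<Sum>i\<in>UNIV. (mean_size g1 g2 / real CARD('n) * ?E $ i) *\<^sub>R axis i (1::real))"
    by (intro has_bochner_integral_sum has_bochner_integral_scaleR_left)
  also have "(\<Sum>i\<in>UNIV. (mean_size g1 g2 / real CARD('n) * ?E $ i) *\<^sub>R axis i 1)
               = (mean_size g1 g2 / real CARD('n)) *\<^sub>R ?E"
    by (simp add: vec_eq_iff axis_def if_distrib sum.delta' cong: if_cong)
  finally have "has_bochner_integral M (\<lambda>\<omega>. ?c *\<^sub>R (A *v (coord_proj (S (Suc k) \<omega>) *v ?w \<omega>)))
          (?c *\<^sub>R (A *v ((mean_size g1 g2 / real CARD('n)) *\<^sub>R ?E)))"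
    unfolding coord_proj_mult
    by (intro has_bochner_integral_scaleR_right
        has_bochner_integral_bounded_linear[OF matrix_vector_mul_bounded_linear])
  then show ?case
    using pos by (simp add: matrix_vector_mul_assoc matrix_vector_mult_scaleR)
qed

end

section \<open>Convergence of the expected averages\<close>

theorem lemma3:
  fixes A :: "real^'n^'n"
    and lam :: "nat \<Rightarrow> real" and v :: "nat \<Rightarrow> real^'n"
    and v0 :: "real^'n"
    and g1 g2 :: nat
    and M :: "'w measure"
    and T :: "nat \<Rightarrow> 'w \<Rightarrow> nat" and S :: "nat \<Rightarrow> 'w \<Rightarrow> 'n set"
  assumes symmetric: "transpose A = A"
    and eigen: "\<And>j. j \<in> {1..CARD('n)} \<Longrightarrow> A *v v j = lam j *\<^sub>R v j"
    and orthonormal: "\<And>i j. i \<in> {1..CARD('n)} \<Longrightarrow> j \<in> {1..CARD('n)} \<Longrightarrow>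
                        v i \<bullet> v j = (if i = j then 1 else 0)"
    and lam_1: "lam 1 = 1"
    and lam_gap: "2 \<le> CARD('n) \<Longrightarrow> \<bar>lam 2\<bar> < lam 1"
    and lam_decr: "\<And>i j. 2 \<le> i \<Longrightarrow> i \<le> j \<Longrightarrow> j \<le> CARD('n) \<Longrightarrow> \<bar>lam j\<bar> \<le> \<bar>lam i\<bar>"
    and bounds: "1 \<le> g1" "g1 \<le> g2" "g2 \<le> CARD('n)"
    and prob: "prob_space M"
    and indep: "prob_space.indep_vars M (\<lambda>_. count_space UNIV) (\<lambda>k \<omega>. (T k \<omega>, S k \<omega>)) {1..}"
    and law: "\<And>k. 1 \<le> k \<Longrightarrow>
                distr M (count_space UNIV) (\<lambda>\<omega>. (T k \<omega>, S k \<omega>)) = measure_pmf (index_pmf g1 g2)"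
    and power_conv: "(\<lambda>k. matrix_pow A k *v v0) \<longlonglongrightarrow> v 1"
  shows "\<exists>\<phi>::real. \<phi> \<noteq> 0 \<and>
    (\<lambda>k. \<integral>\<omega>. m_hat A g1 g2 v0 (\<lambda>j. S j \<omega>) k \<partial>M) \<longlonglongrightarrow> \<phi> *\<^sub>R v 1"
proof -
  interpret prob_space M by (rule prob)
  have indep_S: "indep_vars (\<lambda>_. count_space UNIV) S {1..}"
    using indep_vars_compose2[OF indep, of "\<lambda>_. snd" "\<lambda>_. count_space UNIV"] by simp
  have prob_mem: "expectation (\<lambda>\<omega>. indicator (S k \<omega>) i) = mean_size g1 g2 / real CARD('n)"
    if "1 \<le> k" for k i
  proof -
    have rv: "random_variable (count_space UNIV) (\<lambda>\<omega>. (T k \<omega>, S k \<omega>))"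
      using indep that by (simp add: indep_vars_def)
    have "expectation (\<lambda>\<omega>. indicator (S k \<omega>) i)
          = (\<integral>x. indicat_real (snd x) i \<partial>distr M (count_space UNIV) (\<lambda>\<omega>. (T k \<omega>, S k \<omega>)))"
      using rv by (subst integral_distr) auto
    also have "\<dots> = mean_size g1 g2 / real CARD('n)"
      using bounds by (simp add: law[OF that] expectation_indicator_index_pmf)
    finally show ?thesis .
  qed
  have v_hat: "has_bochner_integral M (\<lambda>\<omega>. v_hat A g1 g2 v0 (\<lambda>j. S j \<omega>) k) (matrix_pow A k *v v0)"
    for k
    using bounds by (intro has_bochner_integral_v_hat indep_S prob_mem mean_size_pos)
  have "has_bochner_integral M (\<lambda>\<omega>. m_hat A g1 g2 v0 (\<lambda>j. S j \<omega>) k)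
          ((1 / real k) *\<^sub>R (\<Sum>j=1..k. matrix_pow A j *v v0))" for k
    unfolding m_hat_eq_average
    by (intro has_bochner_integral_scaleR_right has_bochner_integral_sum v_hat)
  then have "(\<integral>\<omega>. m_hat A g1 g2 v0 (\<lambda>j. S j \<omega>) k \<partial>M)
               = (1 / real k) *\<^sub>R (\<Sum>j=1..k. matrix_pow A j *v v0)" for k
    by (rule has_bochner_integral_integral_eq)
  then have "(\<lambda>k. \<integral>\<omega>. m_hat A g1 g2 v0 (\<lambda>j. S j \<omega>) k \<partial>M) \<longlonglongrightarrow> 1 *\<^sub>R v 1"
    using tendsto_average[OF power_conv] by simp
  then show ?thesis by (intro exI[of _ 1]) simp
qed

end
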